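(* Let $a=(a_1,\dots,a_n)$ and $b=(b_1,\dots,b_m)$ be probability vectors with positive entries and let $C=(c_{ij})\in\mathbb{R}_{\ge 0}^{n\times m}$. For every fixed $\varepsilon>0$, $$\lim_{\lambda\to\infty}\mathrm{OT}_{\varepsilon,\lambda}(a,b)=\mathrm{OT}_{\varepsilon}(a,b)-\varepsilon.$$
   Context: For nonnegative vectors $r,s$ of equal total mass, $\Pi(r,s)$ is the set of nonnegative matrices with row sums $r$ and column sums $s$. The extended marginals are $\widetilde a=(a_1,\dots,a_n,1)$ and $\widetilde b=(b_1,\dots,b_m,1)$. The extended cost matrix has entries $\widetilde c^{\lambda}_{ij}=c_{ij}-2\lambda$ if $1\le i\le n$ and $1\le j\le m$, and $\widetilde c^{\lambda}_{ij}=0$ otherwise (for $1\le i\le n+1$, $1\le j\le m+1$). For a nonnegative matrix $A$, $E(A)=\sum_{i,j}A_{ij}(\log A_{ij}-1)$, with $0\log 0=0$. The entropic partial optimal transport value ($\varepsilon,\lambda>0$) is $$\mathrm{OT}_{\varepsilon,\lambda}(a,b)=\min_{\Gamma\in\Pi(\widetilde a,\widetilde b)}\left\{\sum_{i=1}^{n+1}\sum_{j=1}^{m+1}\widetilde c^{\lambda}_{ij}\Gamma_{ij}+\varepsilon E(\Gamma)+2\lambda\right\},$$ and the balanced entropic optimal transport value is $$\mathrm{OT}_{\varepsilon}(a,b)=\min_{\omega\in\Pi(a,b)}\left\{\sum_{i=1}^{n}\sum_{j=1}^{m}c_{ij}\omega_{ij}+\varepsilon E(\omega)\right\}.$$ 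*)

theory Defs
  imports "HOL-Analysis.Analysis"
begin

text \<open>
  Vectors and matrices are indexed by finite types \<open>'n\<close>, \<open>'m\<close> of cardinalities \<open>n\<close>, \<open>m\<close>. The
  extended index sets \<open>{1..n+1}\<close>, \<open>{1..m+1}\<close> are \<open>'n option\<close>, \<open>'m option\<close>: the original indices
  are \<open>Some i\<close>, and \<open>None\<close> is the additional last index.
\<close>

definition couplings :: "real^'n \<Rightarrow> real^'m \<Rightarrow> (real^'m^'n) set" where
  "couplings r s =
     {M. (\<forall>i j. 0 \<le> M $ i $ j) \<and>
         (\<forall>i. (\<Sum>j\<in>UNIV. M $ i $ j) = r $ i) \<and>
         (\<forall>j. (\<Sum>i\<in>UNIV. M $ i $ j) = s $ j)}"

definition transport_cost :: "real^'m^'n \<Rightarrow> real^'m^'n \<Rightarrow> real" where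
  "transport_cost c M = (\<Sum>i\<in>UNIV. \<Sum>j\<in>UNIV. c $ i $ j * M $ i $ j)"

text \<open>The factor \<open>M $ i $ j\<close> makes zero entries contribute \<open>0\<close>, i.e. \<open>0 log 0 = 0\<close>.\<close>

definition entropy :: "real^'m^'n \<Rightarrow> real" where
  "entropy M = (\<Sum>i\<in>UNIV. \<Sum>j\<in>UNIV. M $ i $ j * (ln (M $ i $ j) - 1))"

definition ext_marginal :: "real^'n \<Rightarrow> real^('n option)" where
  "ext_marginal a = (\<chi> i. case i of None \<Rightarrow> 1 | Some k \<Rightarrow> a $ k)"

definition ext_cost :: "real \<Rightarrow> real^'m^'n \<Rightarrow> real^('m option)^('n option)" where
  "ext_cost l c = (\<chi> i j. case (i, j) of (Some k, Some h) \<Rightarrow> c $ k $ h - 2 * l | _ \<Rightarrow> 0)"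

text \<open>
  The optimal values are minima and not just infima: \<open>LEAST v. v \<in> S\<close> is the element of \<open>S\<close>
  below all others, and is unspecified if \<open>S\<close> has no minimum.
\<close>

definition entropic_ot :: "real \<Rightarrow> real^'m^'n \<Rightarrow> real^'n \<Rightarrow> real^'m \<Rightarrow> real" where
  "entropic_ot \<epsilon> c a b =
     (LEAST v. v \<in> (\<lambda>W. transport_cost c W + \<epsilon> * entropy W) ` couplings a b)"

definition entropic_partial_ot ::
    "real \<Rightarrow> real \<Rightarrow> real^'m^'n \<Rightarrow> real^'n \<Rightarrow> real^'m \<Rightarrow> real" where
  "entropic_partial_ot \<epsilon> l c a b =
     (LEAST v. v \<in> (\<lambda>G. transport_cost (ext_cost l c) G + \<epsilon> * entropy G + 2 * l)
                     ` couplings (ext_marginal a) (ext_marginal b))"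

end

theory Submission
  imports Defs "HOL-Real_Asymp.Real_Asymp"
begin

text \<open>
  If \<open>g G\<close> is one minus the mass that a coupling \<open>G\<close> of the extended marginals puts on the original
  block, the partial objective is a continuous function not depending on \<open>\<lambda>\<close> plus the penalty
  \<open>2 * \<lambda> * g G\<close> on a compact set. As \<open>\<lambda>\<close> tends to infinity, the minimum therefore converges to the
  minimum over the couplings with \<open>g G = 0\<close>. These are the block matrices \<open>diag(W, 1)\<close> with \<open>W\<close> a
  coupling of \<open>a\<close> and \<open>b\<close>; the corner entry 1 contributes \<open>\<epsilon> * 1 * (ln 1 - 1) = - \<epsilon>\<close>.
\<close>

section \<open>Penalized minimization on a compact set\<close>

lemma Least_image_compact:
  fixes f :: "'a::topological_space \<Rightarrow> real"
  assumes "compact K" "K \<noteq> {}" "continuous_on K f"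
  obtains x where "x \<in> K" "(LEAST v. v \<in> f ` K) = f x" "\<And>y. y \<in> K \<Longrightarrow> f x \<le> f y"
proof -
  obtain x where x: "x \<in> K" "\<forall>y\<in>K. f x \<le> f y"
    using continuous_attains_inf[OF assms] by blast
  have "(LEAST v. v \<in> f ` K) = f x"
    by (rule Least_equality) (use x in auto)
  with x that show thesis by blast
qed

text \<open>Penalty method: a zero of \<open>g\<close> pays no penalty, so the minimum over the
  zeros bounds every penalized minimum from above. Conversely, points where \<open>f\<close> is
  clearly smaller have \<open>g\<close> bounded away from 0 and become too expensive for large
  \<open>l\<close>.\<close>

lemma tendsto_Least_penalty:
  fixes f g :: "'a::topological_space \<Rightarrow> real"
  assumes K: "compact K" and f: "continuous_on K f" and g: "continuous_on K g"
    and g0: "\<And>x. x \<in> K \<Longrightarrow> 0 \<le> g x" and Z: "\<exists>x\<in>K. g x = 0"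
  shows "((\<lambda>l. LEAST v. v \<in> (\<lambda>x. f x + l * g x) ` K)
           \<longlongrightarrow> (LEAST v. v \<in> f ` {x \<in> K. g x = 0})) at_top"
proof -
  define Z where "Z = {x \<in> K. g x = 0}"
  have ne: "K \<noteq> {}" "Z \<noteq> {}"
    using Z by (auto simp: Z_def)
  \<comment> \<open>The space need not be Hausdorff, so \<open>K\<close> need not be closed; the
    sublevel set is therefore written as \<open>K\<close> intersected with a closed set.\<close>
  have compact_sub: "compact {x \<in> K. h x \<le> 0}" if cont: "continuous_on K h" for h :: "'a \<Rightarrow> real"
  proof -
    obtain A where A: "closed A" "A \<inter> K = h -` {..0} \<inter> K"
      using cont by (metis closed_atMost continuous_on_closed_invariant)
    have "{x \<in> K. h x \<le> 0} = K \<inter> A"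
      using A(2) by auto
    then show ?thesis
      using compact_Int_closed[OF K A(1)] by simp
  qed
  have "Z = {x \<in> K. g x \<le> 0}"
    using g0 by (force simp: Z_def)
  then have cZ: "compact Z"
    using compact_sub[OF g] by simp
  have "continuous_on Z f"
    by (rule continuous_on_subset[OF f]) (auto simp: Z_def)
  from Least_image_compact[OF cZ ne(2) this] obtain z where
    z: "z \<in> Z" "(LEAST v. v \<in> f ` Z) = f z" "\<And>y. y \<in> Z \<Longrightarrow> f z \<le> f y"
    by blast
  obtain w where w: "w \<in> K" "\<And>y. y \<in> K \<Longrightarrow> f w \<le> f y"
    using Least_image_compact[OF K ne(1) f] by blast
  define L where "L l = (LEAST v. v \<in> (\<lambda>x. f x + l * g x) ` K)" for l
  have attained: "\<exists>x\<in>K. L l = f x + l * g x \<and> L l \<le> f z" for l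
  proof -
    have "continuous_on K (\<lambda>x. f x + l * g x)"
      by (intro continuous_intros f g)
    from Least_image_compact[OF K ne(1) this] obtain x where
      "x \<in> K" "L l = f x + l * g x" "\<And>y. y \<in> K \<Longrightarrow> f x + l * g x \<le> f y + l * g y"
      unfolding L_def by blast
    moreover from this(3)[of z] have "f x + l * g x \<le> f z"
      using z(1) by (simp add: Z_def)
    ultimately show ?thesis by auto
  qed
  have lower: "\<forall>\<^sub>F l in at_top. f z - e < L l" if "e > 0" for e
  proof -
    \<comment> \<open>\<open>B\<close> collects the points that could violate the lower bound. It is
      disjoint from \<open>Z\<close> by minimality of \<open>f z\<close>, so compactness gives a
      positive lower bound \<open>d\<close> for \<open>g\<close> on it.\<close>
    define B where "B = {x \<in> K. f x - (f z - e) \<le> 0}"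
    have cB: "compact B"
      unfolding B_def by (intro compact_sub continuous_intros f)
    obtain d where d: "d > 0" "\<And>x. x \<in> B \<Longrightarrow> d \<le> g x"
    proof (cases "B = {}")
      case True
      then show ?thesis using that[of 1] by auto
    next
      case False
      have "continuous_on B g"
        by (rule continuous_on_subset[OF g]) (auto simp: B_def)
      then obtain x where x: "x \<in> B" "\<forall>y\<in>B. g x \<le> g y"
        using continuous_attains_inf[OF cB False] by blast
      have "g x \<noteq> 0"
        using x(1) z(3)[of x] \<open>e > 0\<close> by (auto simp: B_def Z_def)
      then have "g x > 0"
        using x(1) g0[of x] by (auto simp: B_def)
      then show ?thesis using that x(2) by blast
    qed
    \<comment> \<open>Beyond this threshold the penalty on \<open>B\<close>, at least
      \<open>l * d\<close>, makes up for the largest possible gain \<open>f z - f w\<close>; the 0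
      keeps the penalty nonnegative off \<open>B\<close>.\<close>
    have "\<forall>\<^sub>F l in at_top. l \<ge> max 0 ((f z - f w) / d)"
      by (rule eventually_ge_at_top)
    then show ?thesis
    proof eventually_elim
      case (elim l)
      obtain x where x: "x \<in> K" "L l = f x + l * g x"
        using attained by blast
      show ?case
      proof (cases "x \<in> B")
        case True
        have "f z - f w \<le> l * d"
          using elim d(1) by (simp add: field_simps)
        also have "\<dots> \<le> l * g x"
          using elim d(2)[OF True] by (intro mult_left_mono) auto
        finally show ?thesis
          using x w(2)[of x] \<open>e > 0\<close> by linarith
      next
        case False
        moreover have "0 \<le> l * g x"
          using elim g0[OF x(1)] by auto
        ultimately show ?thesis
          using x by (auto simp: B_def)
      qed
    qed
  qed
  have "(L \<longlongrightarrow> f z) at_top"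
  proof (rule order_tendstoI)
    fix y assume "y < f z"
    then show "\<forall>\<^sub>F l in at_top. y < L l"
      using lower[of "f z - y"] by simp
  next
    fix y assume "f z < y"
    then show "\<forall>\<^sub>F l in at_top. L l < y"
      using attained by (intro always_eventually) (meson le_less_trans)
  qed
  then show ?thesis
    using z(2) by (simp add: L_def[abs_def] Z_def)
qed

section \<open>Continuity of the objective and compactness of couplings\<close>

lemma continuous_on_mult_ln: "continuous_on {0..} (\<lambda>x::real. x * (ln x - 1))"
proof (rule continuous_on_eq_continuous_within[THEN iffD2], intro ballI)
  fix x :: real assume "x \<in> {0..}"
  show "continuous (at x within {0..}) (\<lambda>x. x * (ln x - 1))"
  proof (cases "x = 0")
    case True
    \<comment> \<open>At 0 the logarithm is singular, but \<open>x * ln x\<close> tends to 0 from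
      the right, matching the value there.\<close>
    have "((\<lambda>x::real. x * (ln x - 1)) \<longlongrightarrow> 0) (at_right 0)"
      by real_asymp
    then show ?thesis
      using True by (simp add: continuous_within at_within_Ici_at_right)
  next
    case False
    then show ?thesis
      by (intro continuous_intros)
  qed
qed

lemma continuous_on_entropy:
  assumes "\<And>M i j. M \<in> S \<Longrightarrow> 0 \<le> M $ i $ j"
  shows "continuous_on S entropy"
  unfolding entropy_def
  by (intro continuous_on_sum continuous_on_compose2[OF continuous_on_mult_ln] continuous_intros)
     (use assms in auto)

lemma continuous_on_transport_cost: "continuous_on S (transport_cost c)"
  unfolding transport_cost_def[abs_def] by (intro continuous_intros)

lemma compact_couplings: "compact (couplings r s)"
proof -
  have "closed (couplings r s)"
    unfolding couplings_def
    by (intro closed_Collect_conj closed_Collect_all closed_Collect_le closed_Collect_eq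
        continuous_intros)
  \<comment> \<open>For nonnegative entries the l1 norm of a row is its row sum, and l1 norms
    dominate Euclidean ones.\<close>
  moreover have "norm M \<le> (\<Sum>i\<in>UNIV. r $ i)" if "M \<in> couplings r s" for M
  proof -
    have "norm (M $ i) \<le> r $ i" for i
      using norm_le_l1_cart[of "M $ i"] that by (simp add: couplings_def)
    moreover have "norm M \<le> (\<Sum>i\<in>UNIV. norm (M $ i))"
      unfolding norm_vec_def[of M] by (rule L2_set_le_sum) simp
    ultimately show ?thesis
      by (meson order_trans sum_mono)
  qed
  ultimately show ?thesis
    by (auto simp: compact_eq_bounded_closed bounded_iff)
qed

lemma couplings_nonempty:
  assumes "\<forall>i. 0 \<le> a $ i" "(\<Sum>i\<in>UNIV. a $ i) = 1"
    and "\<forall>j. 0 \<le> b $ j" "(\<Sum>j\<in>UNIV. b $ j) = 1"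
  shows "couplings a b \<noteq> {}"
proof -
  \<comment> \<open>The independent coupling; its marginals are right because both total masses are
    1.\<close>
  have "(\<chi> i j. a $ i * b $ j) \<in> couplings a b"
    using assms by (simp add: couplings_def flip: sum_distrib_left sum_distrib_right)
  then show ?thesis by blast
qed

section \<open>Block structure of the extended problem\<close>

lemma sum_UNIV_option:
  "(\<Sum>i\<in>UNIV. h i) = h None + (\<Sum>i\<in>UNIV. h (Some i))"
  for h :: "'a::finite option \<Rightarrow> 'b::comm_monoid_add"
  by (simp add: UNIV_option_conv sum.reindex)

definition block_embed :: "real^'m^'n \<Rightarrow> real^('m option)^('n option)" where
  "block_embed W = (\<chi> i j. case (i, j) of (Some k, Some h) \<Rightarrow> W $ k $ h | (None, None) \<Rightarrow> 1 | _ \<Rightarrow> 0)"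

lemma block_embed_nth [simp]:
  "block_embed W $ Some k $ Some h = W $ k $ h"
  "block_embed W $ None $ None = 1"
  "block_embed W $ Some k $ None = 0"
  "block_embed W $ None $ Some h = 0"
  by (simp_all add: block_embed_def)

lemma ext_marginal_nth [simp]:
  "ext_marginal a $ None = 1" "ext_marginal a $ Some k = a $ k"
  by (simp_all add: ext_marginal_def)

lemma ext_cost_nth [simp]:
  "ext_cost l c $ Some k $ Some h = c $ k $ h - 2 * l"
  "ext_cost l c $ None $ j = 0"
  "ext_cost l c $ i $ None = 0"
  by (simp_all add: ext_cost_def split: option.splits)

definition block_mass :: "real^('m::finite option)^('n::finite option) \<Rightarrow> real" where
  "block_mass G = (\<Sum>i\<in>UNIV. \<Sum>j\<in>UNIV. G $ Some i $ Some j)"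

text \<open>The shift by \<open>- 2 * l\<close> acts only on the original block, so the whole
  dependence on \<open>l\<close> is through the block mass.\<close>

lemma transport_cost_ext:
  "transport_cost (ext_cost l c) G = transport_cost (ext_cost 0 c) G - 2 * l * block_mass G"
  by (simp add: transport_cost_def block_mass_def sum_UNIV_option left_diff_distrib sum_subtractf
      sum_distrib_left)

lemma transport_cost_block_embed:
  "transport_cost (ext_cost 0 c) (block_embed W) = transport_cost c W"
  by (simp add: transport_cost_def sum_UNIV_option)

lemma entropy_block_embed: "entropy (block_embed W) = entropy W - 1"
  by (simp add: entropy_def sum_UNIV_option)

lemma ext_couplingsD:
  assumes "G \<in> couplings (ext_marginal a) (ext_marginal b)"
  shows "0 \<le> G $ i $ j"
    and "G $ Some k $ None + (\<Sum>h\<in>UNIV. G $ Some k $ Some h) = a $ k"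
    and "G $ None $ None + (\<Sum>h\<in>UNIV. G $ None $ Some h) = 1"
    and "G $ None $ Some h + (\<Sum>k\<in>UNIV. G $ Some k $ Some h) = b $ h"
proof -
  have "(\<Sum>j\<in>UNIV. G $ i $ j) = ext_marginal a $ i" "(\<Sum>i\<in>UNIV. G $ i $ j) = ext_marginal b $ j"
    for i j
    using assms by (auto simp: couplings_def)
  note sums = this[unfolded sum_UNIV_option]
  show "0 \<le> G $ i $ j"
    using assms by (simp add: couplings_def)
  show "G $ Some k $ None + (\<Sum>h\<in>UNIV. G $ Some k $ Some h) = a $ k"
    "G $ None $ None + (\<Sum>h\<in>UNIV. G $ None $ Some h) = 1"
    using sums(1)[of "Some k"] sums(1)[of None] by simp_all
  show "G $ None $ Some h + (\<Sum>k\<in>UNIV. G $ Some k $ Some h) = b $ h"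
    using sums(2)[of "Some h"] by simp
qed

text \<open>Summing the marginal constraints over the original indices. The slack masses are
  nonnegative, so the block mass is at most 1 for probability vectors.\<close>

lemma block_mass_ext_coupling:
  assumes "G \<in> couplings (ext_marginal a) (ext_marginal b)"
  shows "(\<Sum>i\<in>UNIV. a $ i) = (\<Sum>i\<in>UNIV. G $ Some i $ None) + block_mass G"
    and "(\<Sum>j\<in>UNIV. b $ j) = (\<Sum>j\<in>UNIV. G $ None $ Some j) + block_mass G"
proof -
  show "(\<Sum>i\<in>UNIV. a $ i) = (\<Sum>i\<in>UNIV. G $ Some i $ None) + block_mass G"
    by (simp add: block_mass_def flip: sum.distrib ext_couplingsD(2)[OF assms])
  show "(\<Sum>j\<in>UNIV. b $ j) = (\<Sum>j\<in>UNIV. G $ None $ Some j) + block_mass G"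
    unfolding block_mass_def sum.swap[of "\<lambda>i j. G $ Some i $ Some j"]
    by (simp flip: sum.distrib ext_couplingsD(4)[OF assms])
qed

text \<open>Full block mass leaves no slack: nonnegativity kills each entry of the last row and
  column off the corner, and the last marginal then forces the corner to be 1.\<close>

lemma ext_couplings_full_mass:
  assumes a: "(\<Sum>i\<in>UNIV. a $ i) = 1" and b: "(\<Sum>j\<in>UNIV. b $ j) = 1"
  shows "{G \<in> couplings (ext_marginal a) (ext_marginal b). 1 - block_mass G = 0}
           = block_embed ` couplings a b" (is "?Z = _")
proof (intro equalityI subsetI)
  fix G assume "G \<in> ?Z"
  then have G: "G \<in> couplings (ext_marginal a) (ext_marginal b)" and m: "block_mass G = 1"
    by auto
  note nonneg = ext_couplingsD(1)[OF G]
  have sums0: "(\<Sum>i\<in>UNIV. G $ Some i $ None) = 0" "(\<Sum>j\<in>UNIV. G $ None $ Some j) = 0"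
    using block_mass_ext_coupling[OF G] a b m by auto
  then have 0: "G $ Some i $ None = 0" "G $ None $ Some j = 0" for i j
    using nonneg by (simp_all add: sum_nonneg_eq_0_iff)
  define W where "W = (\<chi> i j. G $ Some i $ Some j)"
  have "W \<in> couplings a b"
    using ext_couplingsD(2,4)[OF G] nonneg 0 by (simp add: couplings_def W_def)
  moreover have "G $ i $ j = block_embed W $ i $ j" for i j
    using 0 sums0 ext_couplingsD(3)[OF G] by (cases i; cases j) (simp_all add: W_def)
  then have "G = block_embed W"
    by (simp add: vec_eq_iff)
  ultimately show "G \<in> block_embed ` couplings a b"
    by blast
next
  fix G assume "G \<in> block_embed ` couplings a b"
  then obtain W where W: "W \<in> couplings a b" and G: "G = block_embed W"
    by blast
  have "0 \<le> G $ i $ j" for i j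
    using W by (cases i; cases j) (simp_all add: G couplings_def)
  moreover have "(\<Sum>j\<in>UNIV. G $ i $ j) = ext_marginal a $ i" for i
    using W by (cases i) (simp_all add: G couplings_def sum_UNIV_option)
  moreover have "(\<Sum>i\<in>UNIV. G $ i $ j) = ext_marginal b $ j" for j
    using W by (cases j) (simp_all add: G couplings_def sum_UNIV_option)
  moreover have "block_mass G = 1"
    using W a by (simp add: G couplings_def block_mass_def)
  ultimately show "G \<in> ?Z"
    by (simp add: couplings_def)
qed

section \<open>The limit of the partial transport values\<close>

theorem corollary3p5:
  fixes a :: "real^'n" and b :: "real^'m" and c :: "real^'m^'n" and \<epsilon> :: real
  assumes "\<forall>i. 0 < a $ i" and "(\<Sum>i\<in>UNIV. a $ i) = 1"
    and "\<forall>j. 0 < b $ j" and "(\<Sum>j\<in>UNIV. b $ j) = 1"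
    and "\<forall>i j. 0 \<le> c $ i $ j"
    and "0 < \<epsilon>"
  shows "((\<lambda>l. entropic_partial_ot \<epsilon> l c a b) \<longlongrightarrow> entropic_ot \<epsilon> c a b - \<epsilon>) at_top"
proof -
  define K where "K = couplings (ext_marginal a) (ext_marginal b)"
  define f where "f G = transport_cost (ext_cost 0 c) G + \<epsilon> * entropy G"
    for G :: "real^('m option)^('n option)"
  define g where "g G = 1 - block_mass G" for G :: "real^('m option)^('n option)"
  define h where "h W = transport_cost c W + \<epsilon> * entropy W" for W :: "real^'m^'n"
  have Z: "{G \<in> K. g G = 0} = block_embed ` couplings a b"
    unfolding K_def g_def by (rule ext_couplings_full_mass[OF assms(2,4)])
  have ne: "couplings a b \<noteq> {}"
    using assms by (intro couplings_nonempty) (auto intro: less_imp_le)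
  have "continuous_on K f"
    unfolding f_def
    by (intro continuous_intros continuous_on_transport_cost continuous_on_entropy)
       (auto simp: K_def couplings_def)
  moreover have "continuous_on K g"
    unfolding g_def block_mass_def by (intro continuous_intros)
  moreover have "0 \<le> g G" if "G \<in> K" for G
    using that block_mass_ext_coupling(1)[of G a b] assms(2)
      sum_nonneg[of UNIV "\<lambda>i. G $ Some i $ None"] ext_couplingsD(1)[of G a b]
    by (simp add: K_def g_def)
  moreover have "\<exists>G\<in>K. g G = 0"
    using Z ne by blast
  ultimately have "((\<lambda>l. LEAST v. v \<in> (\<lambda>G. f G + l * g G) ` K)
      \<longlongrightarrow> (LEAST v. v \<in> f ` {G \<in> K. g G = 0})) at_top"
    by (intro tendsto_Least_penalty) (simp_all add: K_def compact_couplings)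
  then have lim: "((\<lambda>l. LEAST v. v \<in> (\<lambda>G. f G + 2 * l * g G) ` K)
      \<longlongrightarrow> (LEAST v. v \<in> f ` {G \<in> K. g G = 0})) at_top"
    by (rule filterlim_compose[of _ _ _ "\<lambda>l. 2 * l"]) real_asymp
  \<comment> \<open>The additive constant \<open>2 * l\<close> of the objective is what completes
    \<open>- 2 * l * block_mass G\<close> to the penalty
    \<open>2 * l * (1 - block_mass G)\<close>.\<close>
  have "(\<lambda>G. f G + 2 * l * g G)
      = (\<lambda>G. transport_cost (ext_cost l c) G + \<epsilon> * entropy G + 2 * l)" for l
    by (rule ext) (simp add: f_def g_def transport_cost_ext[of l] algebra_simps)
  then have partial: "(LEAST v. v \<in> (\<lambda>G. f G + 2 * l * g G) ` K) = entropic_partial_ot \<epsilon> l c a b"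
    for l
    by (simp only: entropic_partial_ot_def K_def)
  have f_embed: "f (block_embed W) = h W - \<epsilon>" for W
    by (simp add: f_def h_def transport_cost_block_embed entropy_block_embed algebra_simps)
  have "continuous_on (couplings a b) h"
    unfolding h_def
    by (intro continuous_intros continuous_on_transport_cost continuous_on_entropy)
       (auto simp: couplings_def)
  from Least_image_compact[OF compact_couplings ne this] obtain W where
    W: "W \<in> couplings a b" "(LEAST v. v \<in> h ` couplings a b) = h W"
      "\<And>V. V \<in> couplings a b \<Longrightarrow> h W \<le> h V"
    by blast
  \<comment> \<open>On the zeros of \<open>g\<close> the function \<open>f\<close> is
    \<open>h\<close> shifted by a constant, so the minimizer \<open>W\<close> of \<open>h\<close>
    yields the minimizer \<open>block_embed W\<close>.\<close>
  have "(LEAST v. v \<in> f ` {G \<in> K. g G = 0}) = h W - \<epsilon>"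
    unfolding Z by (rule Least_equality) (use W in \<open>auto simp: f_embed image_image\<close>)
  also have "h W = entropic_ot \<epsilon> c a b"
    using W(2) by (simp add: entropic_ot_def h_def[abs_def])
  finally show ?thesis
    using lim by (simp add: partial)
qed

end
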